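(* Let $a=(a_0,a_1,\dots)\in\mathbb{R}^{\mathbb{N}}$ and suppose the generating function $G[a](x)=\sum_{k\ge0}a_kx^k$ is irrational. Then for all $t\in\mathbb{N}$, $$\mathsf{space}_a(t)=t+1.$$
   Context: Indices start at $0$, $\mathbb{N}=\{0,1,2,\dots\}$. For $a\in\mathbb{R}^{\mathbb{N}}$, $T[a]$ is the lower-triangular Toeplitz matrix with $T_{i,j}=a_{i-j}$ for $i\ge j$ and $0$ otherwise. Streaming model: a streaming algorithm consists of a buffer size function $\beta:\{-1\}\cup\mathbb{N}\to\mathbb{N}$ with $\beta(-1)=1$ and maps $u^{(t)}:\mathbb{R}^{\beta(t-1)}\times\mathbb{R}\to\mathbb{R}^{\beta(t)}$, $m^{(t)}:\mathbb{R}^{\beta(t)}\to\mathbb{R}$. On input $z\in\mathbb{R}^{\mathbb{N}}$, $s^{(-1)}=0\in\mathbb{R}$, $s^{(t)}=u^{(t)}(s^{(t-1)},z_t)$, output at time $t$ is $m^{(t)}(s^{(t)})$. For each $t$ the map $(z_0,\dots,z_t)\mapsto s^{(t)}$ must be continuous (output maps need not be). The algorithm computes $M$ correctly up to time $\tau$ if $m^{(t)}(s^{(t)})=(Mz)_t$ for all $z$ and all $t\le\tau$. $\mathsf{space}_M(t;\tau)$ is the minimum $b$ such that some streaming algorithm computes $M$ correctly up to time $\tau$ with $\max_{t'\le t}\beta(t')\le b$; $\mathsf{space}_M(t)=\mathsf{space}_M(t;\infty)$ and $\mathsf{space}_a=\mathsf{space}_{T[a]}$. A formal power series $G$ is rational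 if there are polynomials $P,Q$ with $Q(0)\ne0$ and $Q\cdot G=P$; it is irrational if it is not rational. *)

theory Defs
  imports
    "HOL-Analysis.Abstract_Euclidean_Space"
    "HOL-Computational_Algebra.Polynomial_FPS"
    "HOL-Library.Extended_Nat"
begin

definition toeplitz :: "(nat \<Rightarrow> real) \<Rightarrow> nat \<Rightarrow> nat \<Rightarrow> real" where
  "toeplitz a i j = (if j \<le> i then a (i - j) else 0)"

definition mat_apply :: "(nat \<Rightarrow> nat \<Rightarrow> real) \<Rightarrow> (nat \<Rightarrow> real) \<Rightarrow> nat \<Rightarrow> real" where
  "mat_apply M z i = (\<Sum>j. M i j * z j)"

text \<open>
  The space $R^n$ of varying dimension \<open>n\<close> is the library's \<^const>\<open>Euclidean_space\<close>: functions
  \<open>nat \<Rightarrow> real\<close> vanishing at all indices \<open>\<ge> n\<close>, with the product topology.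
  Only the values of \<open>buf\<close> on $\{-1, 0, 1, \ldots\}$ are relevant, and only the values of
  \<open>upd A t\<close> and \<open>out A t\<close> on the spaces of dimension \<open>buf A (t - 1)\<close> and \<open>buf A t\<close>, respectively.
\<close>

record stream_alg =
  buf :: "int \<Rightarrow> nat"
  upd :: "nat \<Rightarrow> (nat \<Rightarrow> real) \<Rightarrow> real \<Rightarrow> (nat \<Rightarrow> real)"
  out :: "nat \<Rightarrow> (nat \<Rightarrow> real) \<Rightarrow> real"

text \<open>The initial state at time $-1$ is the zero vector; it is inlined in the first equation.\<close>

primrec state :: "stream_alg \<Rightarrow> (nat \<Rightarrow> real) \<Rightarrow> nat \<Rightarrow> (nat \<Rightarrow> real)" where
  "state A z 0 = upd A 0 (\<lambda>_. 0) (z 0)"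
| "state A z (Suc t) = upd A (Suc t) (state A z t) (z (Suc t))"

text \<open>
  Since \<^term>\<open>state A z t\<close> depends only on $z_0, \ldots, z_t$, the map
  $(z_0, \ldots, z_t) \mapsto s^{(t)}$ is \<open>\<lambda>z. state A z t\<close> on the space of dimension \<open>t + 1\<close>.
\<close>

definition streaming_algorithm :: "stream_alg \<Rightarrow> bool" where
  "streaming_algorithm A \<longleftrightarrow>
     buf A (-1) = 1 \<and>
     (\<forall>t. \<forall>s \<in> topspace (Euclidean_space (buf A (int t - 1))). \<forall>x.
        upd A t s x \<in> topspace (Euclidean_space (buf A (int t)))) \<and>
     (\<forall>t. continuous_map (Euclidean_space (t + 1)) (Euclidean_space (buf A (int t)))
        (\<lambda>z. state A z t))"

definition computes_upto :: "stream_alg \<Rightarrow> (nat \<Rightarrow> nat \<Rightarrow> real) \<Rightarrow> enat \<Rightarrow> bool" where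
  "computes_upto A M \<tau> \<longleftrightarrow>
     (\<forall>z. \<forall>t. enat t \<le> \<tau> \<longrightarrow> out A t (state A z t) = mat_apply M z t)"

definition space_upto :: "(nat \<Rightarrow> nat \<Rightarrow> real) \<Rightarrow> nat \<Rightarrow> enat \<Rightarrow> nat" where
  "space_upto M t \<tau> =
     (LEAST b. \<exists>A. streaming_algorithm A \<and> computes_upto A M \<tau> \<and>
        Max (buf A ` {-1..int t}) \<le> b)"

definition space_mat :: "(nat \<Rightarrow> nat \<Rightarrow> real) \<Rightarrow> nat \<Rightarrow> nat" where
  "space_mat M t = space_upto M t \<infinity>"

definition space_seq :: "(nat \<Rightarrow> real) \<Rightarrow> nat \<Rightarrow> nat" where
  "space_seq a = space_mat (toeplitz a)"

definition rational_fps :: "real fps \<Rightarrow> bool" where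
  "rational_fps G \<longleftrightarrow>
     (\<exists>P Q :: real poly. poly Q 0 \<noteq> 0 \<and> fps_of_poly Q * G = fps_of_poly P)"

end

theory Submission
  imports Defs "HOL-Homology.Invariance_of_Domain"
begin

text \<open>
  Storing the whole input shows that $t+1$ registers suffice. Conversely, two inputs that vanish
  after time $t$ and lead to the same state at time $t$ produce the same outputs from then on.
  Hence the product of \<open>G[a]\<close> with the polynomial whose coefficients are the difference of the
  inputs is a polynomial, so irrationality of \<open>G[a]\<close> forces the inputs to be equal. The state
  at time $t$ is therefore a continuous injection of $R^{t+1}$ into the buffer space, which by
  invariance of domain has dimension at least $t+1$.
\<close>

text \<open>If n < m, invariance of domain makes the image open in the larger space of dimension m.
  Yet all its points have coordinate \<open>n\<close> equal to 0, which no nonempty open set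
  allows.\<close>

lemma continuous_inj_Euclidean_space_imp_le:
  assumes cont: "continuous_map (Euclidean_space m) (Euclidean_space n) f"
    and inj: "inj_on f (topspace (Euclidean_space m))"
  shows "m \<le> n"
proof (rule ccontr)
  assume "\<not> m \<le> n"
  then have nm: "n < m" by simp
  let ?E = "Euclidean_space m"
  let ?I = "f ` topspace ?E"
  have imn: "?I \<subseteq> topspace (Euclidean_space n)"
    using cont by (rule continuous_map_image_subset_topspace)
  \<comment> \<open>Invariance of domain is applied to self-maps, so \<open>f\<close> is regarded as
    a map into the larger space.\<close>
  have "Euclidean_space n = subtopology ?E (topspace (Euclidean_space n))"
    using nm by (simp add: Euclidean_space_def subtopology_subtopology topspace_Euclidean_space)
      (metis (lifting) inf.absorb_iff2 less_imp_le subset_Euclidean_space topspace_Euclidean_space)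
  then have "continuous_map ?E ?E f"
    using cont continuous_map_in_subtopology by metis
  then have op: "openin ?E ?I"
    using inj by (intro invariance_of_domain_Euclidean_space) auto
  define y where "y = f (\<lambda>_. 0)"
  have yI: "y \<in> ?I"
    by (auto simp: y_def topspace_Euclidean_space)
  then have y0: "y i = 0" if "i \<ge> n" for i
    using imn that by (auto simp: topspace_Euclidean_space)
  \<comment> \<open>This line through \<open>y\<close> stays inside \<open>?E\<close> because n < m,
    but leaves the hyperplane containing \<open>?I\<close> except at s = 0. The preimage of
    \<open>?I\<close> would thus be an open singleton of reals.\<close>
  have "continuous_map euclideanreal ?E (\<lambda>s. y(n := s))"
    unfolding Euclidean_space_def continuous_map_in_subtopology continuous_map_componentwise_UNIV
    using nm y0 by (auto simp: fun_upd_def)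
  then have "open {s. y(n := s) \<in> ?I}"
    using openin_continuous_map_preimage[OF _ op] by fastforce
  moreover have "{s. y(n := s) \<in> ?I} = {0}"
  proof -
    have "s = 0" if "y(n := s) \<in> ?I" for s
    proof -
      have "(y(n := s)) n = 0"
        using subsetD[OF imn that] unfolding topspace_Euclidean_space mem_Collect_eq by blast
      then show ?thesis by simp
    qed
    moreover have "y(n := 0) = y"
      by (simp add: fun_upd_idem y0)
    then have "y(n := 0) \<in> ?I"
      using yI by (simp only:)
    ultimately show ?thesis by blast
  qed
  ultimately show False
    by (simp add: not_open_singleton)
qed

text \<open>The definition asks for a denominator with nonzero constant term. The largest power of X
  dividing \<open>Q\<close> also divides \<open>P\<close>, the product of \<open>Q\<close> and
  \<open>G\<close>, so it can be cancelled from both.\<close>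

lemma rational_fpsI:
  assumes "Q \<noteq> 0" and eq: "fps_of_poly Q * G = fps_of_poly P"
  shows "rational_fps G"
proof -
  define k where "k = subdegree (fps_of_poly Q)"
  have "fps_of_poly Q \<noteq> 0"
    using \<open>Q \<noteq> 0\<close> by (simp add: fps_of_poly_eq_iff flip: fps_of_poly_0)
  then have "fps_nth (fps_of_poly Q) k \<noteq> 0"
    unfolding k_def by (rule nth_subdegree_nonzero)
  then have "poly (poly_shift k Q) 0 \<noteq> 0"
    by (simp add: poly_0_coeff_0 coeff_poly_shift)
  moreover have "fps_of_poly (poly_shift k Q) * G = fps_of_poly (poly_shift k P)"
    using fps_shift_mult_right_noncomm[of k "fps_of_poly Q" G] by (simp add: k_def flip: eq)
  ultimately show ?thesis
    unfolding rational_fps_def by blast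
qed

text \<open>Row \<open>t\<close> vanishes beyond column \<open>t\<close>, so the infinite sum is
  finite and becomes a convolution.\<close>

lemma mat_apply_toeplitz: "mat_apply (toeplitz a) z t = fps_nth (Abs_fps z * Abs_fps a) t"
proof -
  have "mat_apply (toeplitz a) z t = (\<Sum>j\<in>{0..t}. toeplitz a t j * z j)"
    unfolding mat_apply_def by (rule suminf_finite) (auto simp: toeplitz_def)
  also have "\<dots> = fps_nth (Abs_fps z * Abs_fps a) t"
    by (simp add: fps_mult_nth toeplitz_def mult.commute[of "z _"])
  finally show ?thesis .
qed

lemma state_eq_beyond:
  assumes "state A z t = state A z' t" and "\<And>i. i > t \<Longrightarrow> z i = z' i" and "t \<le> s"
  shows "state A z s = state A z' s"
  using \<open>t \<le> s\<close> by (induction s rule: dec_induct) (simp_all add: assms(1,2))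

lemma inj_on_state:
  assumes irr: "\<not> rational_fps (Abs_fps a)" and comp: "computes_upto A (toeplitz a) \<infinity>"
  shows "inj_on (\<lambda>z. state A z t) (topspace (Euclidean_space (t + 1)))"
proof (rule inj_onI, rule ccontr)
  fix z z' assume z: "z \<in> topspace (Euclidean_space (t + 1))"
    and z': "z' \<in> topspace (Euclidean_space (t + 1))"
    and eq: "state A z t = state A z' t" and ne: "z \<noteq> z'"
  let ?W = "Abs_fps z - Abs_fps z'"
  let ?H = "?W * Abs_fps a"
  have "mat_apply (toeplitz a) z s = mat_apply (toeplitz a) z' s" if "s \<ge> t" for s
  proof -
    have "state A z s = state A z' s"
      using z z' by (intro state_eq_beyond[OF eq _ that]) (simp add: topspace_Euclidean_space)
    then show ?thesis
      using comp unfolding computes_upto_def by (metis enat_ord_code(3))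
  qed
  then have "fps_nth ?H s = 0" if "s \<ge> t" for s
    using that by (simp add: mat_apply_toeplitz left_diff_distrib)
  \<comment> \<open>The outputs agree already at time \<open>t\<close>, so \<open>?H\<close> is cut
    at \<open>t\<close>; \<open>?W\<close> may have a nonzero coefficient at \<open>t\<close> and is
    cut at \<open>t + 1\<close>.\<close>
  then have H: "fps_of_poly (truncate_fps t ?H) = ?H"
    by (simp add: fps_eq_iff)
  have W: "fps_of_poly (truncate_fps (t + 1) ?W) = ?W"
    using z z' by (simp add: fps_eq_iff topspace_Euclidean_space)
  have "?W \<noteq> 0"
    using ne by (auto simp: fps_eq_iff)
  then have "truncate_fps (t + 1) ?W \<noteq> 0"
    using W by (metis fps_of_poly_0)
  moreover have "fps_of_poly (truncate_fps (t + 1) ?W) * Abs_fps a = fps_of_poly (truncate_fps t ?H)"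
    unfolding W H ..
  ultimately have "rational_fps (Abs_fps a)"
    by (rule rational_fpsI)
  with irr show False ..
qed

text \<open>The \<open>max 1\<close> supplies the prescribed size 1 at time -1; from time 0 on the
  size is t + 1.\<close>

definition store_all :: "(nat \<Rightarrow> nat \<Rightarrow> real) \<Rightarrow> stream_alg" where
  "store_all M =
     \<lparr>buf = (\<lambda>t. max 1 (nat (t + 1))), upd = (\<lambda>t s x. s(t := x)), out = (\<lambda>t s. mat_apply M s t)\<rparr>"

lemma state_store_all: "state (store_all M) z t = (\<lambda>i. if i \<le> t then z i else 0)"
  by (induction t) (auto simp: store_all_def fun_eq_iff le_Suc_eq)

lemma streaming_algorithm_store_all: "streaming_algorithm (store_all M)"
proof -
  have "continuous_map (Euclidean_space (t + 1)) (Euclidean_space (t + 1))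
          (\<lambda>z. state (store_all M) z t)" for t
    \<comment> \<open>Points of this space vanish beyond index \<open>t\<close>, so the state map is
      the identity on it.\<close>
    by (rule continuous_map_eq[OF continuous_map_id])
      (auto simp: state_store_all topspace_Euclidean_space fun_eq_iff)
  then show ?thesis
    by (auto simp: streaming_algorithm_def store_all_def topspace_Euclidean_space
        max_def nat_add_distrib)
qed

lemma computes_upto_store_all: "computes_upto (store_all (toeplitz a)) (toeplitz a) \<tau>"
proof -
  \<comment> \<open>Padding the stored prefix with zeros is harmless because the matrix is lower
    triangular.\<close>
  have "mat_apply (toeplitz a) (\<lambda>i. if i \<le> t then z i else 0) t = mat_apply (toeplitz a) z t" for z t
    by (simp add: mat_apply_toeplitz fps_mult_nth)
  then show ?thesis
    by (simp add: computes_upto_def state_store_all) (simp add: store_all_def)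
qed

theorem theorem1p8:
  fixes a :: "nat \<Rightarrow> real"
  assumes "\<not> rational_fps (Abs_fps a)"
  shows "\<forall>t. space_seq a t = t + 1"
proof
  fix t
  show "space_seq a t = t + 1"
    unfolding space_seq_def space_mat_def space_upto_def
  proof (rule Least_equality)
    have "Max (buf (store_all (toeplitz a)) ` {-1..int t}) \<le> t + 1"
      by (subst Max_le_iff) (auto simp: store_all_def)
    then show "\<exists>A. streaming_algorithm A \<and> computes_upto A (toeplitz a) \<infinity> \<and>
        Max (buf A ` {-1..int t}) \<le> t + 1"
      using streaming_algorithm_store_all computes_upto_store_all by blast
  next
    fix b
    assume "\<exists>A. streaming_algorithm A \<and> computes_upto A (toeplitz a) \<infinity> \<and>
        Max (buf A ` {-1..int t}) \<le> b"
    then obtain A where A: "streaming_algorithm A" "computes_upto A (toeplitz a) \<infinity>"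
      and b: "Max (buf A ` {-1..int t}) \<le> b"
      by blast
    have "continuous_map (Euclidean_space (t + 1)) (Euclidean_space (buf A (int t)))
        (\<lambda>z. state A z t)"
      using A(1) by (simp add: streaming_algorithm_def)
    then have "t + 1 \<le> buf A (int t)"
      using inj_on_state[OF assms A(2)] by (rule continuous_inj_Euclidean_space_imp_le)
    also have "\<dots> \<le> Max (buf A ` {-1..int t})"
      by (rule Max_ge) auto
    also note b
    finally show "t + 1 \<le> b" .
  qed
qed

end
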